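(* Suppose $X\sim E(\mu,\Sigma)$ has a positive elliptical distribution. Then for all $i\in V$ and $C\subseteq V\setminus\{i\}$ the conditional mean $\mathbb{E}(X_i\mid X_C)$ is an increasing function of $X_C$. Moreover, for any two distinct $i,j\in V$ and $C\subseteq V\setminus\{i,j\}$ it holds that $$\operatorname{corr}(X_i,X_j\mid X_C)\ge 0$$ and $$\operatorname{corr}(X_i,X_j\mid X_C)=0\quad\Longrightarrow\quad \operatorname{corr}(X_i,X_j\mid X_D)=0\ \text{ for all } D \text{ with } C\subseteq D\subseteq V\setminus\{i,j\}.$$
   Context: A random vector $X=(X_1,\dots,X_d)$ has an elliptical distribution, written $X\sim E(\mu,\Sigma)$, if its characteristic function has the form $\boldsymbol t\mapsto \phi(\boldsymbol t^T\Sigma \boldsymbol t)\exp(i\mu^T \boldsymbol t)$ for some $\phi:[0,\infty)\to\mathbb{R}$, where $\mu\in\mathbb{R}^d$ and $\Sigma$ is a $d\times d$ symmetric matrix; $\phi$ is left implicit. Standing assumptions: $\Sigma$ is positive definite and, in the stochastic representation $X=\mu+\xi\,\Sigma^{1/2}U$ with $U$ uniform on the unit sphere of $\mathbb{R}^d$, $\xi\ge 0$ and $\xi$ independent of $U$, one has $0<\mathbb{E}\xi^2<\infty$. Put $V=\{1,\dots,d\}$, $K=\Sigma^{-1}$. $X\sim E(\mu,\Sigma)$ is called positive if all partial correlations $\rho_{ij\cdot V\setminus\{i,j\}}=-K_{ij}/\sqrt{K_{ii}K_{jj}}$, $i\neq j$, are nonnegative; equivalently $K$ is an M-matrix (symmetric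 positive definite with $K_{ij}\le 0$ for all $i\ne j$). $X_C$ is the subvector with coordinates in $C$; conditioning on $X_\emptyset$ means no conditioning. In elliptical distributions conditional correlations $\operatorname{corr}(X_i,X_j\mid X_C)$ do not depend on the value of $X_C$. "Increasing" means coordinatewise non-decreasing. *)

theory Defs
  imports "HOL-Probability.Probability"
begin

definition pos_def_matrix :: "real^'n^'n \<Rightarrow> bool" where
  "pos_def_matrix S \<longleftrightarrow> transpose S = S \<and> (\<forall>v. v \<noteq> 0 \<longrightarrow> 0 < v \<bullet> (S *v v))"

definition elliptical ::
  "'a measure \<Rightarrow> ('a \<Rightarrow> real^'n) \<Rightarrow> real^'n \<Rightarrow> real^'n^'n \<Rightarrow> bool" where
  "elliptical M X \<mu> S \<longleftrightarrow>
     X \<in> borel_measurable M \<and> transpose S = S \<and>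
     (\<exists>\<phi> :: real \<Rightarrow> real. \<forall>t :: real^'n.
        (CLINT \<omega>|M. iexp (t \<bullet> X \<omega>)) = of_real (\<phi> (t \<bullet> (S *v t))) * iexp (\<mu> \<bullet> t))"

text \<open>The normalised cone measure: a Borel set \<open>A\<close> of the sphere gets the proportion of the
  volume of the ball that lies on the rays through \<open>A\<close>. This is the normalised surface measure, and
  for dimension one it is the uniform distribution on \<open>{-1, 1}\<close>.\<close>

definition uniform_sphere :: "(real^'n) measure" where
  "uniform_sphere = distr (uniform_measure lborel (ball 0 1)) borel (\<lambda>x. x /\<^sub>R norm x)"

text \<open>A positive definite matrix has exactly one such root.\<close>

definition is_psd_sqrt :: "real^'n^'n \<Rightarrow> real^'n^'n \<Rightarrow> bool" where
  "is_psd_sqrt B S \<longleftrightarrow> transpose B = B \<and> (\<forall>v. 0 \<le> v \<bullet> (B *v v)) \<and> B ** B = S"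

text \<open>The representation \<open>X = \<mu> + \<xi> S\<^sup>1\<^sup>/\<^sup>2 U\<close> is an equality in distribution, so \<open>\<xi>\<close> and \<open>U\<close>
  may live on a probability space \<open>N\<close> other than that of \<open>X\<close>.\<close>

definition stochastic_representation ::
  "'a measure \<Rightarrow> ('a \<Rightarrow> real^'n) \<Rightarrow> real^'n \<Rightarrow> real^'n^'n \<Rightarrow>
   'b measure \<Rightarrow> ('b \<Rightarrow> real) \<Rightarrow> ('b \<Rightarrow> real^'n) \<Rightarrow> bool" where
  "stochastic_representation M X \<mu> S N \<xi> U \<longleftrightarrow>
     prob_space N \<and>
     \<xi> \<in> borel_measurable N \<and> (AE \<omega> in N. 0 \<le> \<xi> \<omega>) \<and>
     U \<in> borel_measurable N \<and> distr N borel U = uniform_sphere \<and>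
     prob_space.indep_set N
       {\<xi> -` A \<inter> space N | A. A \<in> sets borel} {U -` A \<inter> space N | A. A \<in> sets borel} \<and>
     (\<exists>B. is_psd_sqrt B S \<and>
        distr M borel X = distr N borel (\<lambda>\<omega>. \<mu> + \<xi> \<omega> *\<^sub>R (B *v U \<omega>)))"

text \<open>The partial correlation of the coordinates \<open>i\<close> and \<open>j\<close> given all the others, in terms of
  \<open>K = S\<^sup>-\<^sup>1\<close>.\<close>

definition partial_corr :: "real^'n^'n \<Rightarrow> 'n \<Rightarrow> 'n \<Rightarrow> real" where
  "partial_corr S i j =
     - matrix_inv S $ i $ j / sqrt (matrix_inv S $ i $ i * matrix_inv S $ j $ j)"

definition positive_scale :: "real^'n^'n \<Rightarrow> bool" where
  "positive_scale S \<longleftrightarrow> (\<forall>i j. i \<noteq> j \<longrightarrow> 0 \<le> partial_corr S i j)"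

text \<open>Vectors with coordinates in \<open>C\<close> are extensional functions, i.e. elements of
  \<open>space (Pi\<^sub>M C (\<lambda>_. borel)) = C \<rightarrow>\<^sub>E UNIV\<close>. On these the pointwise order of functions is the
  coordinatewise order on \<open>C\<close>. For \<open>C = {}\<close> the \<open>\<sigma>\<close>-algebra below is trivial.\<close>

definition subvector :: "('a \<Rightarrow> real^'n) \<Rightarrow> 'n set \<Rightarrow> 'a \<Rightarrow> 'n \<Rightarrow> real" where
  "subvector X C \<omega> = (\<lambda>j\<in>C. X \<omega> $ j)"

definition sigma_sub :: "'a measure \<Rightarrow> ('a \<Rightarrow> real^'n) \<Rightarrow> 'n set \<Rightarrow> 'a measure" where
  "sigma_sub M X C = vimage_algebra (space M) (subvector X C) (\<Pi>\<^sub>M j\<in>C. (borel :: real measure))"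

definition cond_mean :: "'a measure \<Rightarrow> ('a \<Rightarrow> real^'n) \<Rightarrow> 'n set \<Rightarrow> 'n \<Rightarrow> 'a \<Rightarrow> real" where
  "cond_mean M X C i = real_cond_exp M (sigma_sub M X C) (\<lambda>\<omega>. X \<omega> $ i)"

definition cond_cov :: "'a measure \<Rightarrow> ('a \<Rightarrow> real^'n) \<Rightarrow> 'n set \<Rightarrow> 'n \<Rightarrow> 'n \<Rightarrow> 'a \<Rightarrow> real" where
  "cond_cov M X C i j = real_cond_exp M (sigma_sub M X C)
     (\<lambda>\<omega>. (X \<omega> $ i - cond_mean M X C i \<omega>) * (X \<omega> $ j - cond_mean M X C j \<omega>))"

text \<open>Where a conditional variance vanishes, the value is \<open>0\<close>, as \<open>x / 0 = 0\<close>. For the elliptical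
  vectors considered here such points are those where \<open>X\<close> is, conditionally, a.s. constant; the complement
  has positive probability, because \<open>\<xi>\<close> is not almost surely \<open>0\<close>.\<close>

definition cond_corr :: "'a measure \<Rightarrow> ('a \<Rightarrow> real^'n) \<Rightarrow> 'n set \<Rightarrow> 'n \<Rightarrow> 'n \<Rightarrow> 'a \<Rightarrow> real" where
  "cond_corr M X C i j \<omega> =
     cond_cov M X C i j \<omega> / sqrt (cond_cov M X C i i \<omega> * cond_cov M X C j j \<omega>)"

text \<open>A conditional mean is determined only almost surely, so being an increasing function of the
  subvector means having an increasing Borel version.\<close>

definition cond_mean_increasing :: "'a measure \<Rightarrow> ('a \<Rightarrow> real^'n) \<Rightarrow> 'n set \<Rightarrow> 'n \<Rightarrow> bool" where
  "cond_mean_increasing M X C i \<longleftrightarrow>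
     (\<exists>g \<in> borel_measurable (\<Pi>\<^sub>M j\<in>C. (borel :: real measure)).
        mono_on (C \<rightarrow>\<^sub>E UNIV) g \<and>
        (AE \<omega> in M. cond_mean M X C i \<omega> = g (subvector X C \<omega>)))"

end

theory Submission
  imports Defs
begin

text \<open>
  Two facts are combined: the conditional means and correlations of an elliptical vector are those
  of linear regression, and for a scale matrix whose inverse \<open>K\<close> is an M-matrix the signs of
  regression quantities are controlled by a maximum principle.

  For the first fact no densities or conditional laws are needed. The law of \<open>X\<close> is invariant under
  every affine reflection that is orthogonal for the quadratic form of \<open>K\<close>
  (\<open>stochastic_representation_reflection\<close>). This rests on the rotation invariance of \<open>U\<close> and its
  independence from \<open>\<xi>\<close>. Reflections that fix \<open>X\<^sub>C\<close> preserve conditional expectations given \<open>X\<^sub>C\<close>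
  (\<open>cond_exp_reflection\<close>). The reflection that negates the residual \<open>L\<^sub>i\<close> of the linear regression of \<open>X\<^sub>i\<close>
  on \<open>X\<^sub>C\<close> shows that its conditional mean is zero, so the conditional mean of \<open>X\<^sub>i\<close> is the regression
  function (\<open>cond_mean_regression\<close>). Reflections that exchange two functionals of equal variance, both
  uncorrelated with \<open>X\<^sub>C\<close>, show that their conditional second moments agree. Hence the conditional covariance
  of \<open>L\<^sub>i\<close> and \<open>L\<^sub>j\<close> is a constant \<open>q\<^sub>i\<^sub>j\<close> times a nonnegative random factor that is the same for all pairs
  (\<open>cond_exp_product\<close>). Therefore, wherever this factor does not vanish, the conditional
  correlation is the constant \<open>q\<^sub>i\<^sub>j / sqrt (q\<^sub>i\<^sub>i q\<^sub>j\<^sub>j)\<close> (\<open>cond_corr_residual\<close>).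

  For the second fact, let \<open>r\<close> be the coefficient vector of \<open>L\<^sub>j\<close> and \<open>y = S r\<close>. Then \<open>y\<^sub>i = q\<^sub>i\<^sub>j\<close> for \<open>i\<close>
  outside \<open>C\<close>, \<open>y = 0\<close> on \<open>C\<close>, and \<open>K y = r\<close> agrees with the \<open>j\<close>th unit vector outside \<open>C\<close>. The maximum principle
  \<open>Mmatrix_maximum_principle\<close> says that \<open>z \<ge> 0\<close> as soon as, in every coordinate, \<open>z\<close> or \<open>K z\<close> is
  nonnegative. Applied to \<open>y\<close> it gives \<open>q\<^sub>i\<^sub>j \<ge> 0\<close>; reading \<open>r = K y\<close> on \<open>C\<close> then gives nonnegative regression
  coefficients, that is, an increasing conditional mean. Applied to the difference of the vectors \<open>y\<close> for
  \<open>C\<close> and for a larger set \<open>D\<close> it shows that \<open>q\<^sub>i\<^sub>j\<close> decreases when the conditioning set grows. A value that is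
  nonnegative, decreasing and zero at \<open>C\<close> stays zero.
\<close>

section \<open>A maximum principle for M-matrices\<close>

text \<open>If the negative part \<open>p\<close> of \<open>z\<close> is tested against \<open>K z\<close>, the hypothesis makes the result nonnegative.
  With \<open>z = q - p\<close> and \<open>q\<close> the positive part, the same quantity is at most \<open>- p \<bullet> K p\<close>, because \<open>p \<bullet> K q\<close>
  involves off-diagonal entries only. Hence \<open>p \<bullet> K p \<le> 0\<close>, that is, \<open>p = 0\<close>.\<close>

lemma Mmatrix_maximum_principle:
  fixes K :: "real^'n^'n" and z :: "real^'n"
  assumes pd: "\<And>v. v \<noteq> 0 \<Longrightarrow> 0 < v \<bullet> (K *v v)"
    and off: "\<And>i j. i \<noteq> j \<Longrightarrow> K $ i $ j \<le> 0"
    and sgn: "\<And>k. 0 \<le> z $ k \<or> 0 \<le> (K *v z) $ k"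
  shows "0 \<le> z $ k"
proof -
  define p :: "real^'n" where "p = (\<chi> k. max 0 (- z $ k))"
  define q :: "real^'n" where "q = (\<chi> k. max 0 (z $ k))"
  have qp: "q = z + p" by (auto simp: p_def q_def vec_eq_iff)
  \<comment> \<open>Where \<open>p\<close> is positive, \<open>z\<close> is negative, so there the second alternative of \<open>sgn\<close> holds.\<close>
  have "0 \<le> p $ k * (K *v z) $ k" for k
    using sgn[of k] by (cases "0 \<le> z $ k") (simp_all add: p_def mult_nonpos_nonneg)
  then have "0 \<le> p \<bullet> (K *v z)"
    unfolding inner_vec_def inner_real_def by (intro sum_nonneg)
  \<comment> \<open>Since \<open>p\<close> and \<open>q\<close> have disjoint supports, only off-diagonal entries of \<open>K\<close> contribute.\<close>
  moreover have "p \<bullet> (K *v q) \<le> 0"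
  proof -
    have "p $ k * (K $ k $ l * q $ l) \<le> 0" for k l
    proof (cases "k = l")
      case True
      then show ?thesis by (auto simp: p_def q_def max_def)
    next
      case False
      have "0 \<le> p $ k" "0 \<le> q $ l" by (auto simp: p_def q_def)
      then show ?thesis using off[OF False]
        by (simp add: mult_nonneg_nonpos mult_nonpos_nonneg)
    qed
    then show ?thesis
      unfolding inner_vec_def matrix_vector_mult_def
      by (auto simp: sum_distrib_left intro!: sum_nonpos)
  qed
  moreover have "p \<bullet> (K *v q) = p \<bullet> (K *v z) + p \<bullet> (K *v p)"
    by (simp add: qp matrix_vector_right_distrib inner_add_right)
  ultimately have "p \<bullet> (K *v p) \<le> 0" by linarith
  then have "p = 0" using pd[of p] by force
  then have "p $ k = 0" by simp
  then show ?thesis by (simp add: p_def)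
qed

section \<open>Positive definite scale matrices\<close>

lemma pos_def_inner_commute:
  assumes "pos_def_matrix S"
  shows "r \<bullet> (S *v s) = s \<bullet> (S *v r)"
  using assms unfolding pos_def_matrix_def
  by (metis dot_lmul_matrix inner_commute transpose_matrix_vector)

lemma pos_def_inverse:
  assumes S: "pos_def_matrix S"
  shows "S *v (matrix_inv S *v v) = v" "matrix_inv S *v (S *v v) = v"
proof -
  have "invertible S"
    unfolding invertible_left_inverse matrix_left_invertible_ker
    using S by (metis inner_zero_right less_irrefl pos_def_matrix_def)
  then have "\<exists>A'. S ** A' = mat 1 \<and> A' ** S = mat 1"
    by (simp add: invertible_def)
  then have "S ** matrix_inv S = mat 1 \<and> matrix_inv S ** S = mat 1"
    unfolding matrix_inv_def by (rule someI_ex)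
  then show "S *v (matrix_inv S *v v) = v" "matrix_inv S *v (S *v v) = v"
    by (simp_all add: matrix_vector_mul_assoc)
qed

lemma pos_def_matrix_inv:
  assumes S: "pos_def_matrix S" and "v \<noteq> 0"
  shows "0 < v \<bullet> (matrix_inv S *v v)"
proof -
  let ?w = "matrix_inv S *v v"
  have "?w \<noteq> 0" using pos_def_inverse(1)[OF S, of v] \<open>v \<noteq> 0\<close> by auto
  then have "0 < ?w \<bullet> (S *v ?w)" using S by (simp add: pos_def_matrix_def)
  then show ?thesis by (simp add: pos_def_inverse[OF S] inner_commute)
qed

lemma positive_scale_off_diagonal:
  assumes S: "pos_def_matrix S" and pos: "positive_scale S" and "i \<noteq> j"
  shows "matrix_inv S $ i $ j \<le> 0"
proof -
  have "0 < matrix_inv S $ k $ k" for k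
    using pos_def_matrix_inv[OF S, of "axis k 1"] by (simp add: matrix_vector_mul_component inner_axis inner_commute[of "axis k 1"] flip: row_def) 
  then have "0 < sqrt (matrix_inv S $ i $ i * matrix_inv S $ j $ j)" by simp
  moreover have "0 \<le> partial_corr S i j" using pos \<open>i \<noteq> j\<close> by (simp add: positive_scale_def)
  ultimately show ?thesis unfolding partial_corr_def
    by (metis neg_0_le_iff_le not_less zero_le_divide_iff)
qed

section \<open>Regression residuals\<close>

text \<open>A vector \<open>r\<close> stands for the linear functional \<open>r \<bullet> (X - \<mu>)\<close>, and \<open>r \<bullet> S s\<close> is, up to a common factor, the
  covariance of two such functionals. The conditions say that \<open>r\<close> differs from the \<open>i\<close>th coordinate by a
  combination of the coordinates in \<open>C\<close> and is uncorrelated with all of these: it is the residual of the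
  linear regression of \<open>X\<^sub>i\<close> on \<open>X\<^sub>C\<close>, and the regression coefficient of \<open>k \<in> C\<close> is \<open>- r\<^sub>k\<close>.\<close>

definition regression_residual :: "real^'n^'n \<Rightarrow> 'n set \<Rightarrow> 'n \<Rightarrow> real^'n \<Rightarrow> bool" where
  "regression_residual S C i r \<longleftrightarrow>
     (\<forall>k\<in>C. (S *v r) $ k = 0) \<and> (\<forall>k. k \<notin> C \<longrightarrow> r $ k = axis i 1 $ k)"

text \<open>The conditions on \<open>r\<close> form a square linear system. It is solvable because its homogeneous version has
  only the zero solution: there, in each coordinate, \<open>r\<close> or \<open>S r\<close> vanishes, so \<open>r \<bullet> S r = 0\<close>.\<close>

lemma regression_residual_exists:
  fixes S :: "real^'n^'n"
  assumes S: "pos_def_matrix S"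
  shows "\<exists>r. regression_residual S C i r"
proof -
  define f :: "real^'n \<Rightarrow> real^'n" where "f r = (\<chi> k. if k \<in> C then (S *v r) $ k else r $ k)" for r
  have lin: "linear f"
    by (rule linearI) (auto simp: f_def vec_eq_iff matrix_vector_right_distrib matrix_vector_mult_scaleR)
  have "r = 0" if "f r = 0" for r
  proof -
    have c: "(if k \<in> C then (S *v r) $ k else r $ k) = 0" for k
      using that by (simp add: f_def vec_eq_iff)
    have "r $ k * (S *v r) $ k = 0" for k
      using c[of k] by (simp split: if_splits)
    then have "r \<bullet> (S *v r) = 0"
      unfolding inner_vec_def inner_real_def by (intro sum.neutral ballI)
    then show "r = 0" using S by (metis less_irrefl pos_def_matrix_def)
  qed
  then have "inj f" using linear_injective_0[OF lin] by blast
  then have "surj f" using lin linear_injective_imp_surjective by blast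
  then obtain r where r: "f r = (\<chi> k. if k \<in> C then 0 else axis i 1 $ k)" by (metis surjD)
  have "(if k \<in> C then (S *v r) $ k else r $ k) = (if k \<in> C then 0 else axis i 1 $ k)" for k
    using r by (simp add: f_def vec_eq_iff)
  then show ?thesis unfolding regression_residual_def by metis
qed

lemma residual_inner:
  assumes "regression_residual S C i r" "\<And>k. k \<in> C \<Longrightarrow> y $ k = 0"
  shows "r \<bullet> y = y $ i"
proof -
  have "r $ k * y $ k = axis i 1 $ k * y $ k" for k
    using assms by (cases "k \<in> C") (auto simp: regression_residual_def)
  then have "r \<bullet> y = axis i 1 \<bullet> y"
    unfolding inner_vec_def inner_real_def by (intro sum.cong refl)
  then show ?thesis by (simp add: inner_axis inner_commute)
qed

text \<open>For residuals \<open>r\<close> and \<open>s\<close> of \<open>i\<close> and \<open>j\<close>, the number \<open>r \<bullet> S s\<close> is the conditional covariance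
  up to a random factor that is common to all pairs, and it is an entry of \<open>S s\<close>. This
  makes the conditional covariances accessible to the maximum principle, applied to \<open>z = S s\<close>.\<close>

lemma residual_scale_inner:
  assumes "regression_residual S C i r" "regression_residual S C j s"
  shows "r \<bullet> (S *v s) = (S *v s) $ i"
  using assms by (intro residual_inner) (auto simp: regression_residual_def)

text \<open>On \<open>C\<close> the vector \<open>S r\<close> is zero; off \<open>C\<close> its image \<open>r\<close> under the inverse of \<open>S\<close> agrees with
  a unit vector.\<close>

lemma residual_nonneg:
  assumes S: "pos_def_matrix S" and pos: "positive_scale S" and r: "regression_residual S C i r"
  shows "0 \<le> (S *v r) $ k"
proof (rule Mmatrix_maximum_principle[OF pos_def_matrix_inv[OF S] positive_scale_off_diagonal[OF S pos]])
  show "0 \<le> (S *v r) $ k \<or> 0 \<le> (matrix_inv S *v (S *v r)) $ k" for k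
    using r by (cases "k \<in> C") (auto simp: regression_residual_def pos_def_inverse[OF S] axis_def)
qed

text \<open>This is the source of the upward stability of zero conditional correlations. On \<open>D\<close> the difference of the
  two sides is \<open>S r \<ge> 0\<close>, and off \<open>D\<close> its image \<open>r - s\<close> under the inverse of \<open>S\<close> is zero.\<close>

lemma residual_antimono:
  assumes S: "pos_def_matrix S" and pos: "positive_scale S" and CD: "C \<subseteq> D"
    and rC: "regression_residual S C i r" and rD: "regression_residual S D i s"
  shows "(S *v s) $ k \<le> (S *v r) $ k"
proof -
  have "0 \<le> (S *v (r - s)) $ k"
  proof (rule Mmatrix_maximum_principle[OF pos_def_matrix_inv[OF S] positive_scale_off_diagonal[OF S pos]])
    show "0 \<le> (S *v (r - s)) $ l \<or> 0 \<le> (matrix_inv S *v (S *v (r - s))) $ l" for l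
      using CD rC rD residual_nonneg[OF S pos rC, of l]
      by (cases "l \<in> D") (auto simp: regression_residual_def pos_def_inverse[OF S] matrix_vector_mult_diff_distrib)
  qed
  then show ?thesis by (simp add: matrix_vector_mult_diff_distrib)
qed

text \<open>Expand \<open>r = S\<^sup>-\<^sup>1 (S r)\<close> in row \<open>k\<close>: the diagonal term drops out since \<open>S r\<close> vanishes on \<open>C\<close>, and the others
  are products of a nonpositive entry of the inverse with an entry of \<open>S r \<ge> 0\<close>.\<close>

lemma residual_coefficient_nonpos:
  assumes S: "pos_def_matrix S" and pos: "positive_scale S" and r: "regression_residual S C i r"
    and "k \<in> C"
  shows "r $ k \<le> 0"
proof -
  have "r $ k = (matrix_inv S *v (S *v r)) $ k" by (simp add: pos_def_inverse[OF S])
  also have "\<dots> = (\<Sum>l\<in>UNIV. matrix_inv S $ k $ l * (S *v r) $ l)"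
    by (simp add: matrix_vector_mult_def[of "matrix_inv S"])
  also have "\<dots> \<le> 0"
  proof (rule sum_nonpos)
    fix l
    show "matrix_inv S $ k $ l * (S *v r) $ l \<le> 0"
    proof (cases "l = k")
      case True
      then show ?thesis using r \<open>k \<in> C\<close> by (simp add: regression_residual_def)
    next
      case False
      then show ?thesis
        using residual_nonneg[OF S pos r, of l] positive_scale_off_diagonal[OF S pos, of k l]
        by (simp add: mult_nonpos_nonneg)
    qed
  qed
  finally show ?thesis .
qed

section \<open>Orthogonal invariance of the uniform distribution on the sphere\<close>

lemma nn_integral_lborel_translate:
  fixes f :: "'b::euclidean_space \<Rightarrow> ennreal"
  assumes [measurable]: "f \<in> borel_measurable borel"
  shows "(\<integral>\<^sup>+ x. f (c + x) \<partial>lborel) = (\<integral>\<^sup>+ x. f x \<partial>lborel)"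
proof -
  have "(\<integral>\<^sup>+ x. f x \<partial>lborel) = (\<integral>\<^sup>+ x. f x \<partial>distr lborel borel ((+) c))"
    by (simp add: lborel_distr_plus)
  then show ?thesis by (simp add: nn_integral_distr)
qed

lemma borel_measurable_orthogonal:
  fixes T :: "'b::euclidean_space \<Rightarrow> 'b"
  assumes "orthogonal_transformation T"
  shows "T \<in> borel_measurable borel"
  using assms by (intro borel_measurable_continuous_onI linear_continuous_on)
    (simp add: linear_conv_bounded_linear[symmetric] orthogonal_transformation_linear)

text \<open>The uniqueness argument for translation invariant measures: with \<open>B\<close> the unit ball, the double integral of
  \<open>1\<^sub>A(T x) 1\<^sub>B(y)\<close> is transformed, by a translation of \<open>y\<close> by \<open>T x\<close> and then a translation of \<open>x\<close> by \<open>T\<^sup>-\<^sup>1 y\<close>,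
  into that of \<open>1\<^sub>A(T x + y) 1\<^sub>B(- T x)\<close>. Here \<open>1\<^sub>B(- T x) = 1\<^sub>B(x)\<close>, as \<open>T\<close> preserves the norm, so both integrals
  factor and the volume of \<open>B\<close> cancels.\<close>

lemma emeasure_lborel_orthogonal_vimage:
  fixes T :: "'b::euclidean_space \<Rightarrow> 'b"
  assumes T: "orthogonal_transformation T" and A[measurable]: "A \<in> sets borel"
  shows "emeasure lborel (T -` A) = emeasure lborel A"
proof -
  note [measurable] = borel_measurable_orthogonal[OF T]
  let ?B = "ball 0 1 :: 'b set"
  let ?iA = "indicator A :: 'b \<Rightarrow> ennreal" and ?iB = "indicator ?B :: 'b \<Rightarrow> ennreal"
  have iAB [measurable]: "?iA \<in> borel_measurable borel" "?iB \<in> borel_measurable borel"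
    by (rule borel_measurable_indicator, simp)+
  have lin: "linear T" using T by (rule orthogonal_transformation_linear)
  have "emeasure lborel (T -` A) * emeasure lborel ?B = (\<integral>\<^sup>+ x. ?iA (T x) * (\<integral>\<^sup>+ y. ?iB y \<partial>lborel) \<partial>lborel)"
  proof -
    have "(\<integral>\<^sup>+ x. ?iA (T x) \<partial>lborel) = (\<integral>\<^sup>+ x. indicator (T -` A) x \<partial>lborel)"
      by (intro nn_integral_cong) (simp add: indicator_def)
    also have "\<dots> = emeasure lborel (T -` A)"
      using measurable_sets[OF borel_measurable_orthogonal[OF T] A] by simp
    finally have "(\<integral>\<^sup>+ x. ?iA (T x) \<partial>lborel) = emeasure lborel (T -` A)" .
    then show ?thesis by (simp add: nn_integral_multc)
  qed
  also have "\<dots> = (\<integral>\<^sup>+ x. (\<integral>\<^sup>+ y. ?iA (T x) * ?iB (- T x + y) \<partial>lborel) \<partial>lborel)"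
  proof (rule nn_integral_cong)
    fix x
    have "(\<integral>\<^sup>+ y. ?iB y \<partial>lborel) = (\<integral>\<^sup>+ y. ?iB (- T x + y) \<partial>lborel)"
      by (rule nn_integral_lborel_translate[symmetric]) (rule iAB)
    then show "?iA (T x) * (\<integral>\<^sup>+ y. ?iB y \<partial>lborel) = (\<integral>\<^sup>+ y. ?iA (T x) * ?iB (- T x + y) \<partial>lborel)"
      using iAB by (simp only:) (rule nn_integral_cmult[symmetric], simp)
  qed
  also have "\<dots> = (\<integral>\<^sup>+ y. (\<integral>\<^sup>+ x. ?iA (T x) * ?iB (- T x + y) \<partial>lborel) \<partial>lborel)"
    by (rule lborel_pair.Fubini') measurable
  also have "\<dots> = (\<integral>\<^sup>+ y. (\<integral>\<^sup>+ x. ?iA (y + T x) * ?iB (- T x) \<partial>lborel) \<partial>lborel)"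
  proof (rule nn_integral_cong)
    fix y
    obtain z where z: "T z = y" using orthogonal_transformation_surj[OF T] by (metis surjD)
    have "(\<integral>\<^sup>+ x. ?iA (T x) * ?iB (- T x + y) \<partial>lborel) =
        (\<integral>\<^sup>+ x. ?iA (T (z + x)) * ?iB (- T (z + x) + y) \<partial>lborel)"
      by (rule nn_integral_lborel_translate[symmetric]) measurable
    then show "(\<integral>\<^sup>+ x. ?iA (T x) * ?iB (- T x + y) \<partial>lborel) = (\<integral>\<^sup>+ x. ?iA (y + T x) * ?iB (- T x) \<partial>lborel)"
      by (simp add: linear_add[OF lin] z)
  qed
  also have "\<dots> = (\<integral>\<^sup>+ x. (\<integral>\<^sup>+ y. ?iA (T x + y) * ?iB (- T x) \<partial>lborel) \<partial>lborel)"
    by (subst lborel_pair.Fubini') (auto simp: add.commute)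
  also have "\<dots> = (\<integral>\<^sup>+ x. emeasure lborel A * ?iB x \<partial>lborel)"
    by (rule nn_integral_cong)
      (simp add: nn_integral_multc nn_integral_lborel_translate[of ?iA],
       simp add: indicator_def orthogonal_transformation_norm[OF T])
  also have "\<dots> = emeasure lborel A * emeasure lborel ?B" by (simp add: nn_integral_cmult)
  finally have "emeasure lborel (T -` A) * emeasure lborel ?B = emeasure lborel A * emeasure lborel ?B" .
  moreover have "emeasure lborel ?B < \<top>" using emeasure_lborel_ball_finite[of "0 :: 'b" 1] by simp
  moreover have "emeasure lborel ?B \<noteq> 0"
  proof
    assume "emeasure lborel ?B = 0"
    then have "?B \<in> null_sets lebesgue" by (auto intro!: null_setsI simp: emeasure_completion)
    then show False using open_not_negligible[of ?B] by (auto simp: negligible_iff_null_sets)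
  qed
  ultimately show ?thesis
    by (auto simp: mult.commute[of _ "emeasure lborel ?B"] ennreal_mult_cancel_left)
qed

lemma distr_uniform_ball_orthogonal:
  fixes T :: "'b::euclidean_space \<Rightarrow> 'b"
  assumes T: "orthogonal_transformation T"
  shows "distr (uniform_measure lborel (ball 0 1)) borel T = uniform_measure lborel (ball 0 1)"
proof (rule measure_eqI)
  note [measurable] = borel_measurable_orthogonal[OF T]
  show "sets (distr (uniform_measure lborel (ball 0 1)) borel T) = sets (uniform_measure lborel (ball 0 1))"
    by simp
  fix A assume "A \<in> sets (distr (uniform_measure lborel (ball 0 1)) borel T)"
  then have A[measurable]: "A \<in> sets borel" by simp
  have "ball 0 1 \<inter> T -` A = T -` (ball 0 1 \<inter> A)"
    by (auto simp: orthogonal_transformation_norm[OF T])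
  then have "emeasure lborel (ball 0 1 \<inter> T -` A) = emeasure lborel (ball 0 1 \<inter> A)"
    by (simp only: emeasure_lborel_orthogonal_vimage[OF T] sets.Int borel_open open_ball A)
  then show "emeasure (distr (uniform_measure lborel (ball 0 1)) borel T) A
      = emeasure (uniform_measure lborel (ball 0 1)) A"
    using measurable_sets[OF borel_measurable_orthogonal[OF T] A]
    by (simp add: emeasure_distr)
qed

lemma uniform_sphere_orthogonal:
  fixes T :: "real^'n \<Rightarrow> real^'n"
  assumes T: "orthogonal_transformation T"
  shows "distr uniform_sphere borel T = uniform_sphere"
proof -
  let ?m = "uniform_measure lborel (ball 0 1) :: (real^'n) measure"
  let ?n = "\<lambda>x :: real^'n. x /\<^sub>R norm x"
  note [measurable] = borel_measurable_orthogonal[OF T]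
  have "T \<circ> ?n = ?n \<circ> T"
    using T by (auto simp: fun_eq_iff orthogonal_transformation_norm linear_cmul orthogonal_transformation_linear)
  then have "distr uniform_sphere borel T = distr (distr ?m borel T) borel ?n"
    by (simp add: uniform_sphere_def distr_distr)
  then show ?thesis by (simp add: distr_uniform_ball_orthogonal[OF T] uniform_sphere_def)
qed

lemma AE_uniform_sphere_norm: "AE x in (uniform_sphere :: (real^'n) measure). norm x = 1"
proof -
  have "AE x :: real^'n in lborel. x \<in> ball 0 1 \<longrightarrow> norm (x /\<^sub>R norm x) = 1"
    using AE_lborel_singleton[of "0 :: real^'n"] by eventually_elim simp
  then show ?thesis
    unfolding uniform_sphere_def by (subst AE_distr_iff) (auto intro!: AE_uniform_measureI)
qed

lemma orthogonal_transformation_reflection: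
  fixes w :: "'b::real_inner"
  assumes "w \<noteq> 0"
  shows "orthogonal_transformation (\<lambda>u. u - (2 * (w \<bullet> u) / (w \<bullet> w)) *\<^sub>R w)"
  unfolding orthogonal_transformation_def
proof (intro conjI allI)
  show "linear (\<lambda>u. u - (2 * (w \<bullet> u) / (w \<bullet> w)) *\<^sub>R w)"
  proof (rule linearI)
    fix u v and c :: real
    show "u + v - (2 * (w \<bullet> (u + v)) / (w \<bullet> w)) *\<^sub>R w =
        (u - (2 * (w \<bullet> u) / (w \<bullet> w)) *\<^sub>R w) + (v - (2 * (w \<bullet> v) / (w \<bullet> w)) *\<^sub>R w)"
      by (simp add: inner_add_right add_divide_distrib distrib_left scaleR_add_left)
    show "c *\<^sub>R u - (2 * (w \<bullet> (c *\<^sub>R u)) / (w \<bullet> w)) *\<^sub>R w =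
        c *\<^sub>R (u - (2 * (w \<bullet> u) / (w \<bullet> w)) *\<^sub>R w)"
      by (simp add: scaleR_diff_right mult.left_commute)
  qed
  fix u v
  define k l where "k = 2 * (w \<bullet> u) / (w \<bullet> w)" and "l = 2 * (w \<bullet> v) / (w \<bullet> w)"
  have "k * (w \<bullet> w) = 2 * (w \<bullet> u)" "l * (w \<bullet> u) = k * (w \<bullet> v)"
    using assms by (simp_all add: k_def l_def)
  then have "(u - k *\<^sub>R w) \<bullet> (v - l *\<^sub>R w) = u \<bullet> v"
    by (simp add: inner_diff_left inner_diff_right inner_commute[of u w])
  then show "(u - (2 * (w \<bullet> u) / (w \<bullet> w)) *\<^sub>R w) \<bullet> (v - (2 * (w \<bullet> v) / (w \<bullet> w)) *\<^sub>R w) = u \<bullet> v"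
    by (simp add: k_def l_def)
qed

section \<open>Reflection invariance of elliptical laws\<close>

text \<open>This is the affine reflection about \<open>\<mu>\<close>, orthogonal for the quadratic form of the inverse of \<open>S\<close>, that
  negates the functional \<open>r \<bullet> (x - \<mu>)\<close> and fixes the functionals \<open>s \<bullet> (x - \<mu>)\<close> with \<open>s \<bullet> S r = 0\<close>.\<close>

definition scale_reflection :: "real^'n \<Rightarrow> real^'n^'n \<Rightarrow> real^'n \<Rightarrow> real^'n \<Rightarrow> real^'n" where
  "scale_reflection \<mu> S r x = x - (2 * (r \<bullet> (x - \<mu>)) / (r \<bullet> (S *v r))) *\<^sub>R (S *v r)"

lemma borel_measurable_scale_reflection [measurable]: "scale_reflection \<mu> S r \<in> borel_measurable borel"
  unfolding scale_reflection_def[abs_def] by measurable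

lemma inner_scale_reflection:
  "s \<bullet> (scale_reflection \<mu> S r x - \<mu>) =
     s \<bullet> (x - \<mu>) - 2 * (r \<bullet> (x - \<mu>)) * (s \<bullet> (S *v r)) / (r \<bullet> (S *v r))"
  unfolding scale_reflection_def by (simp add: inner_diff_right)

lemma (in prob_space) distr_pair_indep:
  assumes [measurable]: "random_variable S Z" "random_variable T W"
    and ind: "\<And>A B. A \<in> sets S \<Longrightarrow> B \<in> sets T \<Longrightarrow>
      prob ((Z -` A \<inter> space M) \<inter> (W -` B \<inter> space M)) = prob (Z -` A \<inter> space M) * prob (W -` B \<inter> space M)"
  shows "distr M (S \<Otimes>\<^sub>M T) (\<lambda>\<omega>. (Z \<omega>, W \<omega>)) = distr M S Z \<Otimes>\<^sub>M distr M T W"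
proof (rule pair_measure_eqI[symmetric])
  interpret Z: prob_space "distr M S Z" by (rule prob_space_distr) simp
  interpret W: prob_space "distr M T W" by (rule prob_space_distr) simp
  show "sigma_finite_measure (distr M S Z)" "sigma_finite_measure (distr M T W)" ..
  show "sets (distr M S Z \<Otimes>\<^sub>M distr M T W) = sets (distr M (S \<Otimes>\<^sub>M T) (\<lambda>\<omega>. (Z \<omega>, W \<omega>)))"
    by simp
  fix A B assume "A \<in> sets (distr M S Z)" "B \<in> sets (distr M T W)"
  then have AB[measurable]: "A \<in> sets S" "B \<in> sets T" by simp_all
  have "(\<lambda>\<omega>. (Z \<omega>, W \<omega>)) -` (A \<times> B) \<inter> space M = (Z -` A \<inter> space M) \<inter> (W -` B \<inter> space M)"
    by auto
  then show "emeasure (distr M S Z) A * emeasure (distr M T W) B =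
      emeasure (distr M (S \<Otimes>\<^sub>M T) (\<lambda>\<omega>. (Z \<omega>, W \<omega>))) (A \<times> B)"
    by (simp add: emeasure_distr emeasure_eq_measure ind ennreal_mult)
qed

text \<open>If \<open>B\<close> is the root of \<open>S\<close>, the reflection acts on \<open>\<mu> + c B u\<close> as the Euclidean reflection \<open>T\<close> of \<open>u\<close> along \<open>B r\<close>.
  So it replaces \<open>U\<close> by \<open>T U\<close>, which has the same joint law with \<open>\<xi>\<close>.\<close>

lemma stochastic_representation_reflection:
  fixes X :: "'a \<Rightarrow> real^'n" and U :: "'b \<Rightarrow> real^'n"
  assumes rep: "stochastic_representation M X \<mu> S N \<xi> U" and S: "pos_def_matrix S"
    and X[measurable]: "X \<in> borel_measurable M" and "r \<noteq> 0"
  shows "distr M borel (\<lambda>\<omega>. scale_reflection \<mu> S r (X \<omega>)) = distr M borel X"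
proof -
  interpret N: prob_space N using rep by (simp add: stochastic_representation_def)
  have [measurable]: "\<xi> \<in> borel_measurable N" "U \<in> borel_measurable N"
    using rep by (auto simp: stochastic_representation_def)
  have U: "distr N borel U = uniform_sphere"
    using rep by (simp add: stochastic_representation_def)
  obtain B where B: "is_psd_sqrt B S" "distr M borel X = distr N borel (\<lambda>\<omega>. \<mu> + \<xi> \<omega> *\<^sub>R (B *v U \<omega>))"
    using rep by (auto simp: stochastic_representation_def)
  have BB: "B *v (B *v v) = S *v v" for v
    using B(1) by (simp add: is_psd_sqrt_def matrix_vector_mul_assoc)
  have Bsym: "u \<bullet> (B *v v) = (B *v u) \<bullet> v" for u v
    using B(1) by (metis dot_lmul_matrix is_psd_sqrt_def transpose_matrix_vector)
  have [measurable]: "(*v) B \<in> borel_measurable borel"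
    by (intro borel_measurable_continuous_onI linear_continuous_on matrix_vector_mul_bounded_linear)
  define w where "w = B *v r"
  define T where "T u = u - (2 * (w \<bullet> u) / (w \<bullet> w)) *\<^sub>R w" for u
  have ww: "w \<bullet> w = r \<bullet> (S *v r)" by (simp add: w_def Bsym flip: BB)
  then have "w \<noteq> 0" using S \<open>r \<noteq> 0\<close> by (metis inner_zero_left less_irrefl pos_def_matrix_def)
  then have T: "orthogonal_transformation T"
    unfolding T_def by (rule orthogonal_transformation_reflection)
  have [measurable]: "T \<in> borel_measurable borel" unfolding T_def[abs_def] by measurable
  have ind: "N.prob ((\<xi> -` A \<inter> space N) \<inter> (U -` B \<inter> space N)) =
      N.prob (\<xi> -` A \<inter> space N) * N.prob (U -` B \<inter> space N)"
    if "A \<in> sets borel" "B \<in> sets borel" for A B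
    using rep that unfolding stochastic_representation_def by (intro N.indep_setD) auto
  have TU: "(\<lambda>\<omega>. T (U \<omega>)) -` B = U -` (T -` B)" for B by auto
  have "distr N (borel \<Otimes>\<^sub>M borel) (\<lambda>\<omega>. (\<xi> \<omega>, T (U \<omega>))) =
      distr N borel \<xi> \<Otimes>\<^sub>M distr N borel (\<lambda>\<omega>. T (U \<omega>))"
  proof (rule N.distr_pair_indep)
    fix A :: "real set" and B :: "(real^'n) set" assume "A \<in> sets borel" "B \<in> sets borel"
    then show "N.prob ((\<xi> -` A \<inter> space N) \<inter> ((\<lambda>\<omega>. T (U \<omega>)) -` B \<inter> space N)) =
        N.prob (\<xi> -` A \<inter> space N) * N.prob ((\<lambda>\<omega>. T (U \<omega>)) -` B \<inter> space N)"
      unfolding TU using measurable_sets[OF \<open>T \<in> borel_measurable borel\<close>, of B] by (intro ind) simp_all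
  qed simp_all
  also have "distr N borel (\<lambda>\<omega>. T (U \<omega>)) = distr N borel U"
    using uniform_sphere_orthogonal[OF T] by (simp flip: U add: distr_distr comp_def)
  also have "distr N borel \<xi> \<Otimes>\<^sub>M distr N borel U = distr N (borel \<Otimes>\<^sub>M borel) (\<lambda>\<omega>. (\<xi> \<omega>, U \<omega>))"
    by (rule N.distr_pair_indep[symmetric]) (simp_all add: ind)
  finally have joint: "distr N (borel \<Otimes>\<^sub>M borel) (\<lambda>\<omega>. (\<xi> \<omega>, T (U \<omega>))) =
      distr N (borel \<Otimes>\<^sub>M borel) (\<lambda>\<omega>. (\<xi> \<omega>, U \<omega>))" .
  let ?h = "\<lambda>(c, u). \<mu> + c *\<^sub>R (B *v u)"
  have refl: "scale_reflection \<mu> S r (\<mu> + c *\<^sub>R (B *v u)) = \<mu> + c *\<^sub>R (B *v T u)" for c u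
    by (simp add: scale_reflection_def T_def ww matrix_vector_mult_diff_distrib matrix_vector_mult_scaleR
        scaleR_diff_right Bsym w_def BB inner_commute[of "S *v r" r])
  have "distr M borel (\<lambda>\<omega>. scale_reflection \<mu> S r (X \<omega>)) = distr (distr M borel X) borel (scale_reflection \<mu> S r)"
    by (simp add: distr_distr comp_def)
  also have "\<dots> = distr N borel (\<lambda>\<omega>. \<mu> + \<xi> \<omega> *\<^sub>R (B *v T (U \<omega>)))"
    by (simp add: B(2) distr_distr comp_def refl)
  also have "\<dots> = distr (distr N (borel \<Otimes>\<^sub>M borel) (\<lambda>\<omega>. (\<xi> \<omega>, T (U \<omega>)))) borel ?h"
    by (simp add: distr_distr comp_def)
  also have "\<dots> = distr M borel X"
    unfolding joint by (simp add: distr_distr comp_def B(2))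
  finally show ?thesis .
qed

text \<open>Both parts hold because \<open>U\<close> has norm one and \<open>B\<close> is bounded and injective, so that \<open>X - \<mu>\<close> is controlled by
  \<open>\<xi>\<close> and vanishes only where \<open>\<xi>\<close> does.\<close>

lemma stochastic_representation_moments:
  fixes X :: "'a \<Rightarrow> real^'n" and U :: "'b \<Rightarrow> real^'n"
  assumes rep: "stochastic_representation M X \<mu> S N \<xi> U" and S: "pos_def_matrix S"
    and X[measurable]: "X \<in> borel_measurable M"
    and int: "integrable N (\<lambda>\<omega>. (\<xi> \<omega>)\<^sup>2)"
  shows "integrable M (\<lambda>\<omega>. (norm (X \<omega> - \<mu>))\<^sup>2)"
    and "(AE \<omega> in M. X \<omega> = \<mu>) \<Longrightarrow> (LINT \<omega>|N. (\<xi> \<omega>)\<^sup>2) = 0"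
proof -
  have [measurable]: "\<xi> \<in> borel_measurable N" "U \<in> borel_measurable N"
    using rep by (auto simp: stochastic_representation_def)
  have U: "distr N borel U = uniform_sphere"
    using rep by (simp add: stochastic_representation_def)
  obtain B where B: "is_psd_sqrt B S" "distr M borel X = distr N borel (\<lambda>\<omega>. \<mu> + \<xi> \<omega> *\<^sub>R (B *v U \<omega>))"
    using rep by (auto simp: stochastic_representation_def)
  have [measurable]: "(*v) B \<in> borel_measurable borel"
    by (intro borel_measurable_continuous_onI linear_continuous_on matrix_vector_mul_bounded_linear)
  have "AE u in distr N borel U. norm u = 1" unfolding U by (rule AE_uniform_sphere_norm)
  then have norm1: "AE \<omega> in N. norm (U \<omega>) = 1" by (simp add: AE_distr_iff)
  have "integrable N (\<lambda>\<omega>. (norm (\<xi> \<omega> *\<^sub>R (B *v U \<omega>)))\<^sup>2)"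
  proof (rule Bochner_Integration.integrable_bound)
    show "integrable N (\<lambda>\<omega>. (onorm ((*v) B))\<^sup>2 * (\<xi> \<omega>)\<^sup>2)" using int by simp
    show "AE \<omega> in N. norm ((norm (\<xi> \<omega> *\<^sub>R (B *v U \<omega>)))\<^sup>2) \<le> norm ((onorm ((*v) B))\<^sup>2 * (\<xi> \<omega>)\<^sup>2)"
      using norm1
    proof eventually_elim
      case (elim \<omega>)
      have "norm (B *v U \<omega>) \<le> onorm ((*v) B)"
        using onorm[OF matrix_vector_mul_bounded_linear, of B "U \<omega>"] elim by simp
      then have "(norm (B *v U \<omega>))\<^sup>2 \<le> (onorm ((*v) B))\<^sup>2" by (simp add: power_mono)
      then show ?case by (simp add: power_mult_distrib mult.commute mult_left_mono)
    qed
  qed simp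
  then have "integrable (distr M borel X) (\<lambda>x. (norm (x - \<mu>))\<^sup>2)"
    unfolding B(2) by (subst integrable_distr_eq) auto
  then show "integrable M (\<lambda>\<omega>. (norm (X \<omega> - \<mu>))\<^sup>2)"
    by (subst (asm) integrable_distr_eq) auto
  assume "AE \<omega> in M. X \<omega> = \<mu>"
  then have "AE x in distr M borel X. x = \<mu>" by (simp add: AE_distr_iff)
  then have "AE \<omega> in N. \<xi> \<omega> *\<^sub>R (B *v U \<omega>) = 0" unfolding B(2) by (simp add: AE_distr_iff)
  with norm1 have "AE \<omega> in N. (\<xi> \<omega>)\<^sup>2 = 0"
  proof eventually_elim
    case (elim \<omega>)
    have "B *v U \<omega> \<noteq> 0"
    proof
      assume "B *v U \<omega> = 0"
      then have "S *v U \<omega> = 0" using B(1) by (metis is_psd_sqrt_def matrix_vector_mul_assoc matrix_vector_mult_0_right)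
      moreover have "U \<omega> \<noteq> 0" using elim by auto
      ultimately show False using S by (metis inner_zero_right less_irrefl pos_def_matrix_def)
    qed
    then show ?case using elim by simp
  qed
  then show "(LINT \<omega>|N. (\<xi> \<omega>)\<^sup>2) = 0" by (simp add: integral_eq_zero_AE)
qed

section \<open>Conditional moments of reflection invariant laws\<close>

text \<open>What the argument uses of an elliptical vector: a nondegenerate, square integrable law that is invariant
  under all reflections.\<close>

locale reflection_invariant = prob_space M
  for M :: "'a measure" +
  fixes X :: "'a \<Rightarrow> real^'n" and \<mu> :: "real^'n" and S :: "real^'n^'n"
  assumes X_measurable [measurable]: "X \<in> borel_measurable M"
    and scale_pos_def: "pos_def_matrix S"
    and square_integrable: "integrable M (\<lambda>\<omega>. (norm (X \<omega> - \<mu>))\<^sup>2)"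
    and nondegenerate: "\<not> (AE \<omega> in M. X \<omega> = \<mu>)"
    and reflection: "r \<noteq> 0 \<Longrightarrow> distr M borel (\<lambda>\<omega>. scale_reflection \<mu> S r (X \<omega>)) = distr M borel X"
begin

abbreviation Y :: "real^'n \<Rightarrow> 'a \<Rightarrow> real" where
  "Y r \<omega> \<equiv> r \<bullet> (X \<omega> - \<mu>)"

abbreviation cexp :: "'n set \<Rightarrow> ('a \<Rightarrow> real) \<Rightarrow> 'a \<Rightarrow> real" where
  "cexp C \<equiv> real_cond_exp M (sigma_sub M X C)"

lemma scale_pos: "r \<noteq> 0 \<Longrightarrow> 0 < r \<bullet> (S *v r)"
  using scale_pos_def by (simp add: pos_def_matrix_def)

lemma coordinate_measurable [measurable]: "(\<lambda>\<omega>. X \<omega> $ i) \<in> borel_measurable M"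
  by (rule measurable_compose[OF X_measurable]) simp

lemma subvector_measurable [measurable]: "subvector X C \<in> measurable M (\<Pi>\<^sub>M j\<in>C. (borel :: real measure))"
  unfolding subvector_def[abs_def] by measurable

lemma sets_sigma_sub:
  "sets (sigma_sub M X C) = {subvector X C -` B \<inter> space M | B. B \<in> sets (\<Pi>\<^sub>M j\<in>C. (borel :: real measure))}"
  unfolding sigma_sub_def
  by (rule sets_vimage_algebra2) (use measurable_space[OF subvector_measurable] in blast)

lemma subvector_sigma_sub [measurable]:
  "subvector X C \<in> measurable (sigma_sub M X C) (\<Pi>\<^sub>M j\<in>C. (borel :: real measure))"
  unfolding sigma_sub_def
  by (rule measurable_vimage_algebra1) (use measurable_space[OF subvector_measurable] in blast)

sublocale sub: finite_measure_subalgebra M "sigma_sub M X C" for C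
proof
  show "subalgebra M (sigma_sub M X C)"
    unfolding subalgebra_def sets_sigma_sub
    by (auto simp: sigma_sub_def intro: measurable_sets[OF subvector_measurable])
qed

text \<open>A reflection along \<open>r\<close> with \<open>S r = 0\<close> on \<open>C\<close> does not move \<open>X\<^sub>C\<close>, so by invariance of the law the pairs of
  \<open>X\<^sub>C\<close> with \<open>f(X)\<close> and of \<open>X\<^sub>C\<close> with the reflected value have the same law.\<close>

lemma cond_exp_reflection:
  assumes [measurable]: "f \<in> borel_measurable borel" "g \<in> borel_measurable borel"
    and fX: "integrable M (\<lambda>\<omega>. f (X \<omega>))"
    and "r \<noteq> 0" and fix_C: "\<And>k. k \<in> C \<Longrightarrow> (S *v r) $ k = 0"
    and fg: "\<And>x. f (scale_reflection \<mu> S r x) = g x"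
  shows "AE \<omega> in M. cexp C (\<lambda>\<omega>. f (X \<omega>)) \<omega> = cexp C (\<lambda>\<omega>. g (X \<omega>)) \<omega>"
proof (rule sub.real_cond_exp_charact)
  let ?R = "scale_reflection \<mu> S r"
  have "integrable (distr M borel (\<lambda>\<omega>. ?R (X \<omega>))) f"
    unfolding reflection[OF \<open>r \<noteq> 0\<close>] using fX by (simp add: integrable_distr_eq)
  then have gX: "integrable M (\<lambda>\<omega>. g (X \<omega>))"
    by (simp add: integrable_distr_eq fg)
  show "integrable M (\<lambda>\<omega>. f (X \<omega>))" by (rule fX)
  show "integrable M (cexp C (\<lambda>\<omega>. g (X \<omega>)))" using gX by (rule sub.real_cond_exp_int)
  fix A assume A: "A \<in> sets (sigma_sub M X C)"
  then obtain B where [measurable]: "B \<in> sets (\<Pi>\<^sub>M j\<in>C. (borel :: real measure))"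
    and AB: "A = subvector X C -` B \<inter> space M"
    by (auto simp: sets_sigma_sub)
  define p :: "real^'n \<Rightarrow> 'n \<Rightarrow> real" where "p x = (\<lambda>j\<in>C. x $ j)" for x
  have [measurable]: "p \<in> measurable borel (\<Pi>\<^sub>M j\<in>C. (borel :: real measure))"
    unfolding p_def[abs_def] by measurable
  have ind: "indicator A \<omega> = (indicator B (p (X \<omega>)) :: real)" if "\<omega> \<in> space M" for \<omega>
    using that by (simp add: AB p_def subvector_def indicator_def)
  have pR: "p (?R x) = p x" for x
    using fix_C by (auto simp: p_def scale_reflection_def fun_eq_iff restrict_def)
  have "(LINT \<omega>:A|M. f (X \<omega>)) = (LINT \<omega>|M. indicator B (p (X \<omega>)) * f (X \<omega>))"
    unfolding set_lebesgue_integral_def by (rule Bochner_Integration.integral_cong) (simp_all add: ind)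
  also have "\<dots> = (LINT x|distr M borel X. indicator B (p x) * f x)"
    by (subst integral_distr) auto
  also have "\<dots> = (LINT \<omega>|M. indicator B (p (X \<omega>)) * g (X \<omega>))"
    unfolding reflection[OF \<open>r \<noteq> 0\<close>, symmetric] by (subst integral_distr) (auto simp: pR fg)
  also have "\<dots> = (LINT \<omega>:A|M. g (X \<omega>))"
    unfolding set_lebesgue_integral_def by (rule Bochner_Integration.integral_cong) (simp_all add: ind)
  also have "\<dots> = (LINT \<omega>:A|M. cexp C (\<lambda>\<omega>. g (X \<omega>)) \<omega>)"
    using gX A by (rule sub.real_cond_exp_intA)
  finally show "(LINT \<omega>:A|M. f (X \<omega>)) = (LINT \<omega>:A|M. cexp C (\<lambda>\<omega>. g (X \<omega>)) \<omega>)" .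
qed simp

lemma integrable_product: "integrable M (\<lambda>\<omega>. Y r \<omega> * Y s \<omega>)"
proof (rule Bochner_Integration.integrable_bound)
  show "integrable M (\<lambda>\<omega>. norm r * norm s * (norm (X \<omega> - \<mu>))\<^sup>2)"
    using square_integrable by simp
  show "AE \<omega> in M. norm (Y r \<omega> * Y s \<omega>) \<le> norm (norm r * norm s * (norm (X \<omega> - \<mu>))\<^sup>2)"
  proof (rule AE_I2)
    fix \<omega>
    have "\<bar>Y r \<omega>\<bar> * \<bar>Y s \<omega>\<bar> \<le> (norm r * norm (X \<omega> - \<mu>)) * (norm s * norm (X \<omega> - \<mu>))"
      by (intro mult_mono Cauchy_Schwarz_ineq2) auto
    then show "norm (Y r \<omega> * Y s \<omega>) \<le> norm (norm r * norm s * (norm (X \<omega> - \<mu>))\<^sup>2)"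
      by (simp add: abs_mult power2_eq_square mult_ac)
  qed
qed simp

lemma integrable_linear: "integrable M (Y r)"
  by (rule square_integrable_imp_integrable) (use integrable_product[of r r] in \<open>simp_all add: power2_eq_square\<close>)

text \<open>The reflection along \<open>r\<close> itself changes the sign of \<open>r \<bullet> (X - \<mu>)\<close>.\<close>

lemma cond_exp_linear_zero:
  assumes "\<And>k. k \<in> C \<Longrightarrow> (S *v r) $ k = 0"
  shows "AE \<omega> in M. cexp C (Y r) \<omega> = 0"
proof (cases "r = 0")
  case True
  have "AE \<omega> in M. cexp C (\<lambda>_. 0) \<omega> = 0"
    by (rule sub.real_cond_exp_F_meas) auto
  then show ?thesis by (simp add: True)
next
  case False
  have neg: "r \<bullet> (scale_reflection \<mu> S r x - \<mu>) = - (r \<bullet> (x - \<mu>))" for x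
    using scale_pos[OF False] by (simp add: inner_scale_reflection)
  have "AE \<omega> in M. cexp C (Y r) \<omega> = cexp C (\<lambda>\<omega>. - (r \<bullet> (X \<omega> - \<mu>))) \<omega>"
    by (rule cond_exp_reflection[where r=r and f="\<lambda>x. r \<bullet> (x - \<mu>)" and g="\<lambda>x. - (r \<bullet> (x - \<mu>))"])
      (use assms False neg integrable_linear in auto)
  moreover have "AE \<omega> in M. cexp C (\<lambda>\<omega>. (-1) * Y r \<omega>) \<omega> = (-1) * cexp C (Y r) \<omega>"
    by (rule sub.real_cond_exp_cmult[OF integrable_linear])
  ultimately show ?thesis by eventually_elim simp
qed

text \<open>Vectors of equal length are exchanged by the reflection along their difference.\<close>

lemma cond_exp_square_swap:
  assumes r: "\<And>k. k \<in> C \<Longrightarrow> (S *v r) $ k = 0" and s: "\<And>k. k \<in> C \<Longrightarrow> (S *v s) $ k = 0"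
    and eq: "r \<bullet> (S *v r) = s \<bullet> (S *v s)"
  shows "AE \<omega> in M. cexp C (\<lambda>\<omega>. Y r \<omega> * Y r \<omega>) \<omega> = cexp C (\<lambda>\<omega>. Y s \<omega> * Y s \<omega>) \<omega>"
proof (cases "r = s")
  case False
  then have pos: "0 < (r - s) \<bullet> (S *v (r - s))" by (intro scale_pos) simp
  have half: "(r - s) \<bullet> (S *v (r - s)) = 2 * (r \<bullet> (S *v (r - s)))"
    using pos_def_inner_commute[OF scale_pos_def, of r s] eq
    by (simp add: matrix_vector_mult_diff_distrib inner_diff_left inner_diff_right)
  then have swap: "r \<bullet> (scale_reflection \<mu> S (r - s) x - \<mu>) = s \<bullet> (x - \<mu>)" for x
  proof -
    have "2 * ((r - s) \<bullet> (x - \<mu>)) * (r \<bullet> (S *v (r - s))) / ((r - s) \<bullet> (S *v (r - s))) = (r - s) \<bullet> (x - \<mu>)"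
      using pos unfolding half by simp
    then show ?thesis unfolding inner_scale_reflection by (simp add: inner_diff_left)
  qed
  show ?thesis
    by (rule cond_exp_reflection[where r="r - s" and f="\<lambda>x. (r \<bullet> (x - \<mu>)) * (r \<bullet> (x - \<mu>))"
          and g="\<lambda>x. (s \<bullet> (x - \<mu>)) * (s \<bullet> (x - \<mu>))"])
      (use False r s swap integrable_product in \<open>auto simp: matrix_vector_mult_diff_distrib\<close>)
qed simp

text \<open>The vector \<open>s\<close> is first rescaled to the length of \<open>r\<close>, measured by \<open>S\<close>.\<close>

lemma cond_exp_square:
  assumes r: "\<And>k. k \<in> C \<Longrightarrow> (S *v r) $ k = 0" and s: "\<And>k. k \<in> C \<Longrightarrow> (S *v s) $ k = 0"
    and "s \<noteq> 0"
  shows "AE \<omega> in M. cexp C (\<lambda>\<omega>. Y r \<omega> * Y r \<omega>) \<omega> =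
    (r \<bullet> (S *v r)) / (s \<bullet> (S *v s)) * cexp C (\<lambda>\<omega>. Y s \<omega> * Y s \<omega>) \<omega>"
proof -
  define c where "c = sqrt ((r \<bullet> (S *v r)) / (s \<bullet> (S *v s)))"
  have "0 \<le> r \<bullet> (S *v r)" using scale_pos[of r] by (cases "r = 0") auto
  then have cc: "c * c = (r \<bullet> (S *v r)) / (s \<bullet> (S *v s))"
    using scale_pos[OF \<open>s \<noteq> 0\<close>] by (simp add: c_def)
  have "AE \<omega> in M. cexp C (\<lambda>\<omega>. Y r \<omega> * Y r \<omega>) \<omega> = cexp C (\<lambda>\<omega>. Y (c *\<^sub>R s) \<omega> * Y (c *\<^sub>R s) \<omega>) \<omega>"
    by (rule cond_exp_square_swap)
      (use r s cc scale_pos[OF \<open>s \<noteq> 0\<close>] in \<open>auto simp: matrix_vector_mult_scaleR mult.assoc[symmetric]\<close>)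
  moreover have "(\<lambda>\<omega>. Y (c *\<^sub>R s) \<omega> * Y (c *\<^sub>R s) \<omega>) = (\<lambda>\<omega>. (c * c) * (Y s \<omega> * Y s \<omega>))"
    by (simp add: fun_eq_iff algebra_simps)
  moreover have "AE \<omega> in M. cexp C (\<lambda>\<omega>. (c * c) * (Y s \<omega> * Y s \<omega>)) \<omega> = (c * c) * cexp C (\<lambda>\<omega>. Y s \<omega> * Y s \<omega>) \<omega>"
    by (rule sub.real_cond_exp_cmult[OF integrable_product])
  ultimately show ?thesis by (auto simp: cc)
qed

text \<open>Conditionally on \<open>X\<^sub>C\<close>, all second moments of functionals uncorrelated with \<open>X\<^sub>C\<close> share one random factor, here
  expressed through an arbitrary reference functional \<open>s\<close>. The case of squares extends by polarisation.\<close>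

lemma cond_exp_product:
  assumes r: "\<And>k. k \<in> C \<Longrightarrow> (S *v r) $ k = 0" and t: "\<And>k. k \<in> C \<Longrightarrow> (S *v t) $ k = 0"
    and s: "\<And>k. k \<in> C \<Longrightarrow> (S *v s) $ k = 0" and "s \<noteq> 0"
  shows "AE \<omega> in M. cexp C (\<lambda>\<omega>. Y r \<omega> * Y t \<omega>) \<omega> =
    (r \<bullet> (S *v t)) / (s \<bullet> (S *v s)) * cexp C (\<lambda>\<omega>. Y s \<omega> * Y s \<omega>) \<omega>"
proof -
  let ?q = "\<lambda>r. r \<bullet> (S *v r)"
  let ?Q = "\<lambda>r \<omega>. Y r \<omega> * Y r \<omega>"
  have polar: "(\<lambda>\<omega>. Y r \<omega> * Y t \<omega>) = (\<lambda>\<omega>. ?Q (r + t) \<omega> / 4 - ?Q (r - t) \<omega> / 4)"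
    by (simp add: fun_eq_iff inner_add_left inner_diff_left field_simps)
  have qpolar: "r \<bullet> (S *v t) = ?q (r + t) / 4 - ?q (r - t) / 4"
    using pos_def_inner_commute[OF scale_pos_def, of r t]
    by (simp add: matrix_vector_mult_diff_distrib matrix_vector_right_distrib
        inner_add_left inner_diff_left inner_add_right inner_diff_right field_simps)
  have "AE \<omega> in M. cexp C (\<lambda>\<omega>. ?Q (r + t) \<omega> / 4 - ?Q (r - t) \<omega> / 4) \<omega> =
      cexp C (\<lambda>\<omega>. ?Q (r + t) \<omega> / 4) \<omega> - cexp C (\<lambda>\<omega>. ?Q (r - t) \<omega> / 4) \<omega>"
    using integrable_product by (intro sub.real_cond_exp_diff) auto
  moreover have "AE \<omega> in M. cexp C (\<lambda>\<omega>. ?Q (r + t) \<omega> / 4) \<omega> = cexp C (?Q (r + t)) \<omega> / 4"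
    by (rule sub.real_cond_exp_cdiv[OF integrable_product])
  moreover have "AE \<omega> in M. cexp C (\<lambda>\<omega>. ?Q (r - t) \<omega> / 4) \<omega> = cexp C (?Q (r - t)) \<omega> / 4"
    by (rule sub.real_cond_exp_cdiv[OF integrable_product])
  moreover have "AE \<omega> in M. cexp C (?Q (r + t)) \<omega> = ?q (r + t) / ?q s * cexp C (?Q s) \<omega>"
    by (rule cond_exp_square) (use r t s \<open>s \<noteq> 0\<close> in \<open>auto simp: matrix_vector_right_distrib\<close>)
  moreover have "AE \<omega> in M. cexp C (?Q (r - t)) \<omega> = ?q (r - t) / ?q s * cexp C (?Q s) \<omega>"
    by (rule cond_exp_square) (use r t s \<open>s \<noteq> 0\<close> in \<open>auto simp: matrix_vector_mult_diff_distrib\<close>)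
  ultimately show ?thesis
    unfolding polar qpolar
    by eventually_elim (simp add: diff_divide_distrib left_diff_distrib)
qed

text \<open>By the proportionality of second moments, for \<open>C = {}\<close>, one vanishing second moment would force all
  coordinates of \<open>X - \<mu>\<close> to vanish almost surely.\<close>

lemma expectation_square_nonzero:
  assumes "s \<noteq> 0"
  shows "expectation (\<lambda>\<omega>. Y s \<omega> * Y s \<omega>) \<noteq> 0"
proof
  assume zero: "expectation (\<lambda>\<omega>. Y s \<omega> * Y s \<omega>) = 0"
  have "AE \<omega> in M. Y r \<omega> = 0" for r
  proof -
    have "expectation (cexp {} (\<lambda>\<omega>. Y r \<omega> * Y r \<omega>)) =
        expectation (\<lambda>\<omega>. (r \<bullet> (S *v r)) / (s \<bullet> (S *v s)) * cexp {} (\<lambda>\<omega>. Y s \<omega> * Y s \<omega>) \<omega>)"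
      by (rule integral_cong_AE) (use cond_exp_square[of "{}" r s] \<open>s \<noteq> 0\<close> in auto)
    then have "expectation (\<lambda>\<omega>. Y r \<omega> * Y r \<omega>) = 0"
      using zero by (simp add: sub.real_cond_exp_int(2)[OF integrable_product])
    then have "AE \<omega> in M. Y r \<omega> * Y r \<omega> = 0"
      using integral_nonneg_eq_0_iff_AE[OF integrable_product[of r r]] by simp
    then show ?thesis by simp
  qed
  then have "AE \<omega> in M. \<forall>k. Y (axis k 1) \<omega> = 0" by (simp add: AE_all_countable)
  then have "AE \<omega> in M. X \<omega> = \<mu>"
    by eventually_elim (simp add: vec_eq_iff inner_axis inner_commute[of "axis _ _"])
  then show False using nondegenerate by contradiction
qed

lemma residual_linear:
  assumes r: "regression_residual S C i r" and "i \<notin> C"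
  shows "X \<omega> $ i = Y r \<omega> + (\<mu> $ i + (\<Sum>k\<in>C. - r $ k * (X \<omega> $ k - \<mu> $ k)))"
proof -
  let ?y = "X \<omega> - \<mu>"
  have "Y r \<omega> = (\<Sum>k\<in>UNIV. r $ k * ?y $ k)" by (simp add: inner_vec_def)
  also have "\<dots> = (\<Sum>k\<in>C. r $ k * ?y $ k) + (\<Sum>k\<in>- C. r $ k * ?y $ k)"
    by (subst sum.union_disjoint[symmetric]) auto
  also have "(\<Sum>k\<in>- C. r $ k * ?y $ k) = (\<Sum>k\<in>- C. if k = i then ?y $ i else 0)"
    by (rule sum.cong) (use r in \<open>auto simp: regression_residual_def axis_def\<close>)
  also have "\<dots> = ?y $ i" using \<open>i \<notin> C\<close> by (simp add: sum.delta)
  finally show ?thesis by (simp add: sum_negf)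
qed

lemma cond_mean_regression:
  assumes r: "regression_residual S C i r" and "i \<notin> C"
  shows "AE \<omega> in M. cond_mean M X C i \<omega> = \<mu> $ i + (\<Sum>k\<in>C. - r $ k * (subvector X C \<omega> k - \<mu> $ k))"
proof -
  let ?g = "\<lambda>v. \<mu> $ i + (\<Sum>k\<in>C. - r $ k * (v k - \<mu> $ k))"
  have lin: "?g (subvector X C \<omega>) = X \<omega> $ i - Y r \<omega>" for \<omega>
    using residual_linear[OF r \<open>i \<notin> C\<close>, of \<omega>] by (simp add: subvector_def)
  have "integrable M (\<lambda>\<omega>. Y (axis i 1) \<omega> + \<mu> $ i - Y r \<omega>)"
    using integrable_linear by auto
  then have int: "integrable M (\<lambda>\<omega>. ?g (subvector X C \<omega>))"
    unfolding lin by (simp add: inner_axis inner_commute[of "axis _ _"])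
  have g: "?g \<in> borel_measurable (\<Pi>\<^sub>M j\<in>C. (borel :: real measure))" by measurable
  have "AE \<omega> in M. cexp C (\<lambda>\<omega>. Y r \<omega> + ?g (subvector X C \<omega>)) \<omega> =
      cexp C (Y r) \<omega> + cexp C (\<lambda>\<omega>. ?g (subvector X C \<omega>)) \<omega>"
    by (rule sub.real_cond_exp_add[OF integrable_linear int])
  moreover have "AE \<omega> in M. cexp C (\<lambda>\<omega>. ?g (subvector X C \<omega>)) \<omega> = ?g (subvector X C \<omega>)"
    by (rule sub.real_cond_exp_F_meas[OF int measurable_compose[OF subvector_sigma_sub g]])
  moreover have "AE \<omega> in M. cexp C (Y r) \<omega> = 0"
    using r by (intro cond_exp_linear_zero) (auto simp: regression_residual_def)
  moreover have "(\<lambda>\<omega>. Y r \<omega> + ?g (subvector X C \<omega>)) = (\<lambda>\<omega>. X \<omega> $ i)"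
    by (simp only: lin) simp
  ultimately show ?thesis unfolding cond_mean_def by auto
qed

lemma cond_cov_residual:
  assumes r: "regression_residual S C i r" and "i \<notin> C"
    and s: "regression_residual S C j s" and "j \<notin> C"
  shows "AE \<omega> in M. cond_cov M X C i j \<omega> = cexp C (\<lambda>\<omega>. Y r \<omega> * Y s \<omega>) \<omega>"
  unfolding cond_cov_def
proof (rule sub.real_cond_exp_cong)
  have res: "AE \<omega> in M. X \<omega> $ i - cond_mean M X C i \<omega> = Y r \<omega>"
    if "regression_residual S C i r" "i \<notin> C" for i r
    using cond_mean_regression[OF that]
    by eventually_elim (use residual_linear[OF that] in \<open>simp add: subvector_def\<close>)
  show "AE \<omega> in M. (X \<omega> $ i - cond_mean M X C i \<omega>) * (X \<omega> $ j - cond_mean M X C j \<omega>) = Y r \<omega> * Y s \<omega>"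
    using res[OF r \<open>i \<notin> C\<close>] res[OF s \<open>j \<notin> C\<close>] by eventually_elim simp
qed (unfold cond_mean_def, measurable)

text \<open>The common factor \<open>H\<close> of the conditional covariances cancels in the conditional correlation wherever it is not
  zero. Where it is zero the conditional correlation has the default value of \<open>0 / 0\<close>; this set, the complement
  of \<open>P\<close>, does not have full measure.\<close>

lemma cond_corr_residual:
  assumes r: "regression_residual S C i r" and i: "i \<notin> C"
    and s: "regression_residual S C j s" and j: "j \<notin> C"
  shows "\<exists>P. \<not> (AE \<omega> in M. \<not> P \<omega>) \<and>
    (AE \<omega> in M. cond_corr M X C i j \<omega> =
      (if P \<omega> then (r \<bullet> (S *v s)) / sqrt ((r \<bullet> (S *v r)) * (s \<bullet> (S *v s))) else 0))"
proof -
  have r0: "\<And>k. k \<in> C \<Longrightarrow> (S *v r) $ k = 0" and s0: "\<And>k. k \<in> C \<Longrightarrow> (S *v s) $ k = 0"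
    using r s by (auto simp: regression_residual_def)
  have "r $ i = 1" "s $ j = 1" using r s i j by (auto simp: regression_residual_def)
  then have "r \<noteq> 0" "s \<noteq> 0" by auto
  let ?q = "\<lambda>r s. r \<bullet> (S *v s)"
  have q: "0 < ?q r r" "0 < ?q s s" using scale_pos \<open>r \<noteq> 0\<close> \<open>s \<noteq> 0\<close> by auto
  define H where "H = (\<lambda>\<omega>. cexp C (\<lambda>\<omega>. Y r \<omega> * Y r \<omega>) \<omega> / ?q r r)"
  have nz: "\<not> (AE \<omega> in M. \<not> H \<omega> \<noteq> 0)"
  proof
    assume "AE \<omega> in M. \<not> H \<omega> \<noteq> 0"
    then have "AE \<omega> in M. cexp C (\<lambda>\<omega>. Y r \<omega> * Y r \<omega>) \<omega> = 0"
      by eventually_elim (use q in \<open>simp add: H_def\<close>)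
    then have "expectation (cexp C (\<lambda>\<omega>. Y r \<omega> * Y r \<omega>)) = 0"
      by (rule integral_eq_zero_AE)
    then show False
      using expectation_square_nonzero[OF \<open>r \<noteq> 0\<close>] sub.real_cond_exp_int(2)[OF integrable_product] by simp
  qed
  have H0: "AE \<omega> in M. 0 \<le> cexp C (\<lambda>\<omega>. Y r \<omega> * Y r \<omega>) \<omega>"
    by (rule sub.real_cond_exp_pos) auto
  have cov: "AE \<omega> in M. cond_cov M X C i' j' \<omega> = ?q r' s' * H \<omega>"
    if "regression_residual S C i' r'" "i' \<notin> C" "regression_residual S C j' s'" "j' \<notin> C" for i' j' r' s'
  proof -
    have "AE \<omega> in M. cexp C (\<lambda>\<omega>. Y r' \<omega> * Y s' \<omega>) \<omega> = ?q r' s' / ?q r r * cexp C (\<lambda>\<omega>. Y r \<omega> * Y r \<omega>) \<omega>"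
      by (rule cond_exp_product) (use that r0 \<open>r \<noteq> 0\<close> in \<open>auto simp: regression_residual_def\<close>)
    with cond_cov_residual[OF that] show ?thesis
      by eventually_elim (simp add: H_def)
  qed
  have "AE \<omega> in M. cond_corr M X C i j \<omega> = (if H \<omega> \<noteq> 0 then ?q r s / sqrt (?q r r * ?q s s) else 0)"
    using H0 cov[OF r i s j] cov[OF r i r i] cov[OF s j s j]
  proof eventually_elim
    case (elim \<omega>)
    have "0 \<le> H \<omega>" using elim(1) q by (simp add: H_def)
    have "sqrt (?q r r * H \<omega> * (?q s s * H \<omega>)) = sqrt ((?q r r * ?q s s) * (H \<omega>)\<^sup>2)"
      by (simp add: power2_eq_square mult_ac)
    also have "\<dots> = sqrt (?q r r * ?q s s) * H \<omega>"
      using \<open>0 \<le> H \<omega>\<close> by (simp add: real_sqrt_mult)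
    finally show ?case by (simp add: cond_corr_def elim)
  qed
  with nz show ?thesis by (intro exI[of _ "\<lambda>\<omega>. H \<omega> \<noteq> 0"]) auto
qed

lemma cond_corr_zero_iff:
  assumes r: "regression_residual S C i r" and i: "i \<notin> C"
    and s: "regression_residual S C j s" and j: "j \<notin> C"
  shows "(AE \<omega> in M. cond_corr M X C i j \<omega> = 0) \<longleftrightarrow> r \<bullet> (S *v s) = 0"
proof
  obtain P where P: "\<not> (AE \<omega> in M. \<not> P \<omega>)"
    and corr: "AE \<omega> in M. cond_corr M X C i j \<omega> =
      (if P \<omega> then (r \<bullet> (S *v s)) / sqrt ((r \<bullet> (S *v r)) * (s \<bullet> (S *v s))) else 0)"
    using cond_corr_residual[OF assms] by blast
  {
    assume "r \<bullet> (S *v s) = 0"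
    then show "AE \<omega> in M. cond_corr M X C i j \<omega> = 0" using corr by auto
  next
    assume zero: "AE \<omega> in M. cond_corr M X C i j \<omega> = 0"
    show "r \<bullet> (S *v s) = 0"
    proof (rule ccontr)
      assume nz: "r \<bullet> (S *v s) \<noteq> 0"
      then have "r \<noteq> 0" "s \<noteq> 0" by auto
      then have "0 < r \<bullet> (S *v r)" "0 < s \<bullet> (S *v s)" using scale_pos by auto
      with nz have "AE \<omega> in M. \<not> P \<omega>" using zero corr by (auto elim!: eventually_elim2 split: if_splits)
      with P show False by contradiction
    qed
  }
qed

lemma cond_corr_nonneg:
  assumes r: "regression_residual S C i r" and i: "i \<notin> C"
    and s: "regression_residual S C j s" and j: "j \<notin> C"
    and nonneg: "0 \<le> r \<bullet> (S *v s)"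
  shows "AE \<omega> in M. 0 \<le> cond_corr M X C i j \<omega>"
proof -
  obtain P where corr: "AE \<omega> in M. cond_corr M X C i j \<omega> =
      (if P \<omega> then (r \<bullet> (S *v s)) / sqrt ((r \<bullet> (S *v r)) * (s \<bullet> (S *v s))) else 0)"
    using cond_corr_residual[OF r i s j] by blast
  have "0 \<le> r \<bullet> (S *v r)" "0 \<le> s \<bullet> (S *v s)"
    using scale_pos[of r] scale_pos[of s] by (cases "r = 0"; cases "s = 0"; simp)+
  with nonneg corr show ?thesis by (auto elim!: eventually_mono)
qed

lemma cond_mean_increasing_if_positive:
  assumes pos: "positive_scale S" and "i \<notin> C"
  shows "cond_mean_increasing M X C i"
proof -
  obtain r where r: "regression_residual S C i r"
    using regression_residual_exists[OF scale_pos_def] by blast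
  let ?g = "\<lambda>v. \<mu> $ i + (\<Sum>k\<in>C. - r $ k * (v k - \<mu> $ k))"
  have "?g \<in> borel_measurable (\<Pi>\<^sub>M j\<in>C. (borel :: real measure))" by measurable
  moreover have "mono_on (C \<rightarrow>\<^sub>E UNIV) ?g"
  proof (rule mono_onI)
    fix v w :: "'n \<Rightarrow> real" assume "v \<le> w"
    then show "?g v \<le> ?g w"
      using residual_coefficient_nonpos[OF scale_pos_def pos r]
      by (intro add_left_mono sum_mono mult_left_mono diff_right_mono) (auto simp: le_fun_def)
  qed
  ultimately show ?thesis
    unfolding cond_mean_increasing_def using cond_mean_regression[OF r \<open>i \<notin> C\<close>] by blast
qed

end

section \<open>Positive elliptical distributions\<close>

theorem proposition4p12:
  fixes M :: "'a measure" and X :: "'a \<Rightarrow> real^'n" and \<mu> :: "real^'n" and S :: "real^'n^'n"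
    and N :: "'b measure" and \<xi> :: "'b \<Rightarrow> real" and U :: "'b \<Rightarrow> real^'n"
  assumes "prob_space M"
    and "elliptical M X \<mu> S"
    and "pos_def_matrix S"
    and "stochastic_representation M X \<mu> S N \<xi> U"
    and "integrable N (\<lambda>\<omega>. (\<xi> \<omega>)\<^sup>2)"
    and "0 < (LINT \<omega>|N. (\<xi> \<omega>)\<^sup>2)"
    and "positive_scale S"
  shows "(\<forall>i C. C \<subseteq> UNIV - {i} \<longrightarrow> cond_mean_increasing M X C i) \<and>
    (\<forall>i j C. i \<noteq> j \<longrightarrow> C \<subseteq> UNIV - {i, j} \<longrightarrow>
       (AE \<omega> in M. 0 \<le> cond_corr M X C i j \<omega>) \<and>
       ((AE \<omega> in M. cond_corr M X C i j \<omega> = 0) \<longrightarrow>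
          (\<forall>D. C \<subseteq> D \<longrightarrow> D \<subseteq> UNIV - {i, j} \<longrightarrow> (AE \<omega> in M. cond_corr M X D i j \<omega> = 0))))"
proof -
  have X: "X \<in> borel_measurable M" using assms(2) by (simp add: elliptical_def)
  interpret reflection_invariant M X \<mu> S
  proof (intro reflection_invariant.intro reflection_invariant_axioms.intro)
    show "\<not> (AE \<omega> in M. X \<omega> = \<mu>)"
      using stochastic_representation_moments(2)[OF assms(4,3) X assms(5)] assms(6) by auto
  qed (use assms X stochastic_representation_moments(1)[OF assms(4,3) X assms(5)]
      stochastic_representation_reflection[OF assms(4,3) X] in auto)
  have res: "\<exists>r. regression_residual S C i r" for C i
    by (rule regression_residual_exists[OF scale_pos_def])
  note nonneg = residual_nonneg[OF scale_pos_def assms(7)]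
  show ?thesis
  proof (intro conjI allI impI)
    fix i C assume "C \<subseteq> UNIV - {i :: 'n}"
    then show "cond_mean_increasing M X C i"
      by (intro cond_mean_increasing_if_positive assms(7)) auto
  next
    fix i j :: 'n and C assume "C \<subseteq> UNIV - {i, j}"
    moreover obtain r s where "regression_residual S C i r" "regression_residual S C j s"
      using res by meson
    ultimately show "AE \<omega> in M. 0 \<le> cond_corr M X C i j \<omega>"
      by (intro cond_corr_nonneg) (auto simp: residual_scale_inner nonneg)
  next
    fix i j :: 'n and C D
    assume C: "C \<subseteq> UNIV - {i, j}" and zero: "AE \<omega> in M. cond_corr M X C i j \<omega> = 0"
      and "C \<subseteq> D" and D: "D \<subseteq> UNIV - {i, j}"
    obtain r s where rs: "regression_residual S C i r" "regression_residual S C j s"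
      using res by meson
    obtain r' s' where rs': "regression_residual S D i r'" "regression_residual S D j s'"
      using res by meson
    have "(S *v s) $ i = 0"
      using zero C cond_corr_zero_iff[OF rs(1) _ rs(2)] residual_scale_inner[OF rs] by auto
    then have "(S *v s') $ i \<le> 0"
      using residual_antimono[OF scale_pos_def assms(7) \<open>C \<subseteq> D\<close> rs(2) rs'(2), of i] by simp
    then have "(S *v s') $ i = 0" using nonneg[OF rs'(2), of i] by simp
    then show "AE \<omega> in M. cond_corr M X D i j \<omega> = 0"
      using D cond_corr_zero_iff[OF rs'(1) _ rs'(2)] residual_scale_inner[OF rs'] by auto
  qed
qed

end
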